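(* Let $\nu\in\mathcal{V}$ and $n\in\mathbb{N}$, and let $f$ be a suitable function (e.g. a polynomial or a holomorphic function), i.e. such that $R_{\nu}R_{\nu+\sigma}\cdots R_{\nu+(n-1)\sigma}f$ is defined and the Leibniz rule for $\partial^n$ applies to the product $w_{\nu+n\sigma}\cdot f$. Then $$\bigl(R_{\nu}R_{\nu+\sigma}\cdots R_{\nu+(n-2)\sigma}R_{\nu+(n-1)\sigma}f\bigr)(x)=\sum_{k=0}^n\alpha^n_k\,\frac{\bigl(\eta^k(w_{\nu+k\sigma})\bigr)(x)}{w_\nu(x)}\,\bigl(\eta^k(p^{(\nu+k\sigma)}_{n-k})\bigr)(x)\,(T_{k,n}f)(x).$$
   Context: Setting. $\mathcal{V}$ is a (multi-parameter) set of parameters in some $\mathbb{R}^d$, and $\sigma\in\mathbb{R}^d$ is a fixed element such that $\nu\in\mathcal{V}$ implies $\nu+k\sigma\in\mathcal{V}$ for all $k\in\mathbb{N}=\{0,1,2,\dots\}$. For each $\nu\in\mathcal{V}$, $\mu^{(\nu)}$ is a positive Borel measure on $\mathbb{R}$ with infinite support and all moments finite. For each $\nu\in\mathcal V$ there is a densely defined raising operator $R_\nu: L^2(\mu^{(\nu+\sigma)})\to L^2(\mu^{(\nu)})$ mapping polynomials of degree $n$ to polynomials of degree $n+1$; its adjoint $L_\nu=(R_\nu)^*: L^2(\mu^{(\nu)})\to L^2(\mu^{(\nu+\sigma)})$ is a densely defined lowering operator, mapping polynomials of degree $n$ to polynomials of degree $n-1$ (and constants to $0$). All polynomials are in the domains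 of $R_\nu$ and $L_\nu$. Set $$p_n^{(\nu)}=R_\nu R_{\nu+\sigma}\cdots R_{\nu+(n-1)\sigma}\mathbf{1},$$ where $\mathbf 1$ is the constant function $1$ (so $p_0^{(\nu)}=\mathbf 1$); these are orthogonal polynomials for $\mu^{(\nu)}$. It is assumed that $R_\nu=M_\nu^{-1}\circ\partial\circ M_{\nu+\sigma}$, where $(M_\nu f)(x)=w_\nu(x)f(x)$ for a function $w_\nu$ with $w_\nu>0$ $\mu^{(\nu)}$-a.e., and $\partial$ is a linear operator on functions, independent of $\nu$, with the $w_\nu$ in the domain of $\partial$ (and of its powers as needed). It is assumed that there is a Leibniz rule: for all $n\in\mathbb N$ and all functions $f,g$ for which the expressions are well defined, $$\bigl(\partial^n(fg)\bigr)(x)=\sum_{k=0}^n\alpha^n_k\,(\eta^k\partial^{n-k}f)(x)\,(T_{k,n}g)(x),$$ where $\alpha^n_k$ are constants, $\eta$ is a fixed invertible homomorphism acting on functions (so $\eta(fg)=\eta(f)\eta(g)$), and $T_{k,n}$ are fixed operators on functions. *)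

theory Defs
  imports "HOL-Analysis.Analysis"
begin

text \<open>
  The functions on which the operators act are total functions on the complex plane; the real
  line, which carries the measures, sits in it through \<^const>\<open>of_real\<close>. Complex arguments are
  needed because the operators may involve complex shifts of the argument. A function living on a
  smaller set is represented by an extension, for example by zero.
\<close>

type_synonym cfun = "complex \<Rightarrow> complex"

definition msupport :: "real measure \<Rightarrow> real set" where
  "msupport M = {x. \<forall>U. open U \<longrightarrow> x \<in> U \<longrightarrow> emeasure M U > 0}"

definition L2_space :: "real measure \<Rightarrow> cfun set" where
  "L2_space M = {f. (\<lambda>x. f (of_real x)) \<in> borel_measurable M \<and>
                    integrable M (\<lambda>x. (cmod (f (of_real x)))\<^sup>2)}"

definition L2_inner :: "real measure \<Rightarrow> cfun \<Rightarrow> cfun \<Rightarrow> complex" where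
  "L2_inner M f g = integral\<^sup>L M (\<lambda>x. f (of_real x) * cnj (g (of_real x)))"

definition dense_in_L2 :: "real measure \<Rightarrow> cfun set \<Rightarrow> bool" where
  "dense_in_L2 M A \<longleftrightarrow> A \<subseteq> L2_space M \<and>
     (\<forall>f\<in>L2_space M. \<forall>e>0. \<exists>g\<in>A. integral\<^sup>L M (\<lambda>x. (cmod (f (of_real x) - g (of_real x)))\<^sup>2) < e)"

definition cfun_subspace :: "cfun set \<Rightarrow> bool" where
  "cfun_subspace A \<longleftrightarrow> (\<lambda>x. 0) \<in> A \<and>
     (\<forall>f\<in>A. \<forall>g\<in>A. \<forall>a b. (\<lambda>x. a * f x + b * g x) \<in> A)"

text \<open>Domain of the adjoint of an operator \<open>A\<close> from the \<open>L\<^sup>2\<close> space of \<open>M\<close> to that of \<open>N\<close>, with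
  domain \<open>domA\<close>.\<close>

definition adjoint_dom :: "real measure \<Rightarrow> real measure \<Rightarrow> cfun set \<Rightarrow> (cfun \<Rightarrow> cfun) \<Rightarrow> cfun set" where
  "adjoint_dom M N domA A =
     {g \<in> L2_space N. \<exists>h\<in>L2_space M. \<forall>f\<in>domA. L2_inner N (A f) g = L2_inner M f h}"

definition mult_op :: "cfun \<Rightarrow> cfun \<Rightarrow> cfun" where
  "mult_op w f = (\<lambda>x. w x * f x)"

text \<open>Domain of the \<open>n\<close>-th power of a partial operator \<open>D\<close> with domain \<open>domD\<close>, inside the class \<open>F\<close>
  of functions under consideration.\<close>

primrec power_dom :: "cfun set \<Rightarrow> cfun set \<Rightarrow> (cfun \<Rightarrow> cfun) \<Rightarrow> nat \<Rightarrow> cfun set" where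
  "power_dom F domD D 0 = F"
| "power_dom F domD D (Suc n) = {f \<in> domD. D f \<in> power_dom F domD D n}"

text \<open>Natural domain of the composition \<open>M\<^sub>\<nu>\<^sup>-\<^sup>1 \<circ> D \<circ> M\<^sub>\<nu>\<^sub>+\<^sub>\<sigma>\<close> (\<open>v = w\<^sub>\<nu>\<close>, \<open>u = w\<^sub>\<nu>\<^sub>+\<^sub>\<sigma>\<close>), the inverse of a
  multiplication operator being defined on its range.\<close>

definition conj_dom :: "cfun set \<Rightarrow> cfun set \<Rightarrow> (cfun \<Rightarrow> cfun) \<Rightarrow> cfun \<Rightarrow> cfun \<Rightarrow> cfun set" where
  "conj_dom F domD D v u =
     {f \<in> F. mult_op u f \<in> domD \<and> D (mult_op u f) \<in> mult_op v ` F}"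

text \<open>\<open>raise R \<sigma> n \<nu> f = R\<^sub>\<nu> R\<^sub>\<nu>\<^sub>+\<^sub>\<sigma> \<dots> R\<^sub>\<nu>\<^sub>+\<^sub>(\<^sub>n\<^sub>-\<^sub>1\<^sub>)\<^sub>\<sigma> f\<close>, and the condition that it is defined.\<close>

primrec raise :: "('v::monoid_add \<Rightarrow> cfun \<Rightarrow> cfun) \<Rightarrow> 'v \<Rightarrow> nat \<Rightarrow> 'v \<Rightarrow> cfun \<Rightarrow> cfun" where
  "raise R \<sigma> 0 \<nu> f = f"
| "raise R \<sigma> (Suc n) \<nu> f = R \<nu> (raise R \<sigma> n (\<nu> + \<sigma>) f)"

primrec raise_defined :: "cfun set \<Rightarrow> cfun set \<Rightarrow> (cfun \<Rightarrow> cfun) \<Rightarrow> ('v::monoid_add \<Rightarrow> cfun) \<Rightarrow>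
    ('v \<Rightarrow> cfun \<Rightarrow> cfun) \<Rightarrow> 'v \<Rightarrow> nat \<Rightarrow> 'v \<Rightarrow> cfun \<Rightarrow> bool" where
  "raise_defined F domD D w R \<sigma> 0 \<nu> f \<longleftrightarrow> f \<in> F"
| "raise_defined F domD D w R \<sigma> (Suc n) \<nu> f \<longleftrightarrow>
     raise_defined F domD D w R \<sigma> n (\<nu> + \<sigma>) f \<and>
     raise R \<sigma> n (\<nu> + \<sigma>) f \<in> conj_dom F domD D (w \<nu>) (w (\<nu> + \<sigma>))"

definition raise_poly :: "('v::monoid_add \<Rightarrow> cfun \<Rightarrow> cfun) \<Rightarrow> 'v \<Rightarrow> nat \<Rightarrow> 'v \<Rightarrow> cfun" where
  "raise_poly R \<sigma> n \<nu> = raise R \<sigma> n \<nu> (\<lambda>x. 1)"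

text \<open>All expressions in the Leibniz rule for \<open>D\<^sup>n (f g)\<close> are defined.\<close>

definition leibniz_applies :: "cfun set \<Rightarrow> cfun set \<Rightarrow> (cfun \<Rightarrow> cfun) \<Rightarrow> (nat \<Rightarrow> nat \<Rightarrow> cfun set) \<Rightarrow>
    nat \<Rightarrow> cfun \<Rightarrow> cfun \<Rightarrow> bool" where
  "leibniz_applies F domD D domT n f g \<longleftrightarrow>
     f \<in> F \<and> g \<in> F \<and> (\<lambda>x. f x * g x) \<in> power_dom F domD D n \<and>
     (\<forall>k\<le>n. f \<in> power_dom F domD D (n - k) \<and> g \<in> domT k n)"

locale raising_setting =
  fixes V :: "(real ^ 'd) set"
    and \<sigma> :: "real ^ 'd"
    and \<mu> :: "real ^ 'd \<Rightarrow> real measure"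
    and F :: "cfun set"
    and w :: "real ^ 'd \<Rightarrow> cfun"
    and domD :: "cfun set" and D :: "cfun \<Rightarrow> cfun"
    and \<eta> :: "cfun \<Rightarrow> cfun"
    and domT :: "nat \<Rightarrow> nat \<Rightarrow> cfun set" and T :: "nat \<Rightarrow> nat \<Rightarrow> cfun \<Rightarrow> cfun"
    and \<alpha> :: "nat \<Rightarrow> nat \<Rightarrow> complex" \<comment> \<open>\<open>\<alpha> n k\<close> is the coefficient with upper index \<open>n\<close>, lower index \<open>k\<close>\<close>
    and domR :: "real ^ 'd \<Rightarrow> cfun set" and R :: "real ^ 'd \<Rightarrow> cfun \<Rightarrow> cfun"
    and L :: "real ^ 'd \<Rightarrow> cfun \<Rightarrow> cfun"
  assumes shift_closed: "\<And>\<nu> k. \<nu> \<in> V \<Longrightarrow> \<nu> + real k *\<^sub>R \<sigma> \<in> V"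
    and borel: "\<And>\<nu>. \<nu> \<in> V \<Longrightarrow> sets (\<mu> \<nu>) = sets borel"
    and infinite_support: "\<And>\<nu>. \<nu> \<in> V \<Longrightarrow> infinite (msupport (\<mu> \<nu>))"
    and moments: "\<And>\<nu> n. \<nu> \<in> V \<Longrightarrow> integrable (\<mu> \<nu>) (\<lambda>x. x ^ n)"

    \<comment> \<open>The class of functions; \<open>F = UNIV\<close> is allowed.\<close>
    and F_subspace: "cfun_subspace F"
    and F_mult: "\<And>f g. f \<in> F \<Longrightarrow> g \<in> F \<Longrightarrow> (\<lambda>x. f x * g x) \<in> F"
    and F_poly: "\<And>p. poly p \<in> F"

    and D_subspace: "cfun_subspace domD"
    and D_maps: "domD \<subseteq> F" "\<And>f. f \<in> domD \<Longrightarrow> D f \<in> F"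
    and D_linear: "\<And>f g a b. f \<in> domD \<Longrightarrow> g \<in> domD \<Longrightarrow>
          D (\<lambda>x. a * f x + b * g x) = (\<lambda>x. a * D f x + b * D g x)"
    and w_pos: "\<And>\<nu>. \<nu> \<in> V \<Longrightarrow> AE x in \<mu> \<nu>. w \<nu> (of_real x) \<in> \<real> \<and> 0 < Re (w \<nu> (of_real x))"
    and w_dom: "\<And>\<nu>. \<nu> \<in> V \<Longrightarrow> w \<nu> \<in> domD"
    and w_power_dom: "\<And>\<nu> n. \<nu> \<in> V \<Longrightarrow> w (\<nu> + real n *\<^sub>R \<sigma>) \<in> power_dom F domD D n"
    and \<eta>_bij: "bij_betw \<eta> F F"
    and \<eta>_mult: "\<And>f g. f \<in> F \<Longrightarrow> g \<in> F \<Longrightarrow> \<eta> (\<lambda>x. f x * g x) = (\<lambda>x. \<eta> f x * \<eta> g x)"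
    and leibniz: "\<And>n f g x. leibniz_applies F domD D domT n f g \<Longrightarrow>
          (D ^^ n) (\<lambda>x. f x * g x) x =
            (\<Sum>k=0..n. \<alpha> n k * (\<eta> ^^ k) ((D ^^ (n - k)) f) x * T k n g x)"

    \<comment> \<open>\<open>R\<^sub>\<nu> = M\<^sub>\<nu>\<^sup>-\<^sup>1 \<circ> D \<circ> M\<^sub>\<nu>\<^sub>+\<^sub>\<sigma>\<close>. As \<open>w\<^sub>\<nu>\<close> may vanish on a null set, \<open>R\<^sub>\<nu> f\<close> is some preimage under
      \<open>M\<^sub>\<nu>\<close> of \<open>D (M\<^sub>\<nu>\<^sub>+\<^sub>\<sigma> f)\<close>; it is determined wherever \<open>w\<^sub>\<nu>\<close> is nonzero.\<close>
    and R_conj: "\<And>\<nu> f. \<nu> \<in> V \<Longrightarrow> f \<in> conj_dom F domD D (w \<nu>) (w (\<nu> + \<sigma>)) \<Longrightarrow>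
          R \<nu> f \<in> F \<and> mult_op (w \<nu>) (R \<nu> f) = D (mult_op (w (\<nu> + \<sigma>)) f)"

    \<comment> \<open>\<open>domR \<nu>\<close> is the domain of \<open>R\<^sub>\<nu>\<close> as a densely defined operator between \<open>L\<^sup>2\<close> spaces, and may be
      smaller than the natural domain of the composition above.\<close>
    and domR_conj: "\<And>\<nu>. \<nu> \<in> V \<Longrightarrow> domR \<nu> \<subseteq> conj_dom F domD D (w \<nu>) (w (\<nu> + \<sigma>))"
    and domR_subspace: "\<And>\<nu>. \<nu> \<in> V \<Longrightarrow> cfun_subspace (domR \<nu>)"
    and domR_dense: "\<And>\<nu>. \<nu> \<in> V \<Longrightarrow> dense_in_L2 (\<mu> (\<nu> + \<sigma>)) (domR \<nu>)"
    and R_L2: "\<And>\<nu> f. \<nu> \<in> V \<Longrightarrow> f \<in> domR \<nu> \<Longrightarrow> R \<nu> f \<in> L2_space (\<mu> \<nu>)"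
    and R_AE_cong: "\<And>\<nu> f g. \<nu> \<in> V \<Longrightarrow> f \<in> domR \<nu> \<Longrightarrow> g \<in> domR \<nu> \<Longrightarrow>
          AE x in \<mu> (\<nu> + \<sigma>). f (of_real x) = g (of_real x) \<Longrightarrow>
          AE x in \<mu> \<nu>. R \<nu> f (of_real x) = R \<nu> g (of_real x)"
    and R_poly_dom: "\<And>\<nu> p. \<nu> \<in> V \<Longrightarrow> poly p \<in> domR \<nu>"
    and R_poly: "\<And>\<nu> p. \<nu> \<in> V \<Longrightarrow> p \<noteq> 0 \<Longrightarrow>
          \<exists>q. R \<nu> (poly p) = poly q \<and> degree q = degree p + 1"

    and L_adjoint: "\<And>\<nu> g. \<nu> \<in> V \<Longrightarrow> g \<in> adjoint_dom (\<mu> (\<nu> + \<sigma>)) (\<mu> \<nu>) (domR \<nu>) (R \<nu>) \<Longrightarrow>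
          L \<nu> g \<in> L2_space (\<mu> (\<nu> + \<sigma>)) \<and>
          (\<forall>f\<in>domR \<nu>. L2_inner (\<mu> \<nu>) (R \<nu> f) g = L2_inner (\<mu> (\<nu> + \<sigma>)) f (L \<nu> g))"
    and L_dense: "\<And>\<nu>. \<nu> \<in> V \<Longrightarrow>
          dense_in_L2 (\<mu> \<nu>) (adjoint_dom (\<mu> (\<nu> + \<sigma>)) (\<mu> \<nu>) (domR \<nu>) (R \<nu>))"
    and L_poly_dom: "\<And>\<nu> p. \<nu> \<in> V \<Longrightarrow>
          poly p \<in> adjoint_dom (\<mu> (\<nu> + \<sigma>)) (\<mu> \<nu>) (domR \<nu>) (R \<nu>)"
    and L_poly: "\<And>\<nu> p. \<nu> \<in> V \<Longrightarrow> degree p \<ge> 1 \<Longrightarrow>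
          \<exists>q. q \<noteq> 0 \<and> L \<nu> (poly p) = poly q \<and> degree q = degree p - 1"
    and L_const: "\<And>\<nu> c. \<nu> \<in> V \<Longrightarrow> L \<nu> (\<lambda>x. c) = (\<lambda>x. 0)"

end

theory Submission
  imports Defs
begin

text \<open>
  Each raising operator is the operator \<open>D\<close> conjugated by multiplication with
  weights, and the weight that \<open>R\<^sub>\<nu>\<close> divides by is the one that the operator to its left multiplies
  with. A product of raising operators therefore telescopes:
  \<open>w\<^sub>\<nu> \<cdot> (R\<^sub>\<nu> \<dots> R\<^bsub>\<nu>+(n-1)\<sigma>\<^esub> f) = D\<^sup>n (w\<^bsub>\<nu>+n\<sigma>\<^esub> \<cdot> f)\<close> (\<open>weight_mult_raise\<close>).
  For \<open>f = 1\<close> this is a Rodrigues formula, \<open>w\<^sub>\<nu> \<cdot> p\<^sub>m = D\<^sup>m w\<^bsub>\<nu>+m\<sigma>\<^esub>\<close>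
  (\<open>rodrigues_formula\<close>).

  The Leibniz rule expands \<open>D\<^sup>n (w\<^bsub>\<nu>+n\<sigma>\<^esub> \<cdot> f)\<close> into terms containing
  \<open>\<eta>\<^sup>k (D\<^bsup>n-k\<^esup> w\<^bsub>\<nu>+n\<sigma>\<^esub>)\<close>. Since \<open>\<nu> + n\<sigma> = (\<nu> + k\<sigma>) + (n-k)\<sigma>\<close>, the Rodrigues formula at parameter
  \<open>\<nu> + k\<sigma>\<close> rewrites the argument of \<open>\<eta>\<^sup>k\<close> as \<open>w\<^bsub>\<nu>+k\<sigma>\<^esub> \<cdot> p\<^bsub>n-k\<^esub>\<close>, and multiplicativity of \<open>\<eta>\<close>
  separates the two factors. Dividing by \<open>w\<^sub>\<nu>\<close> at the points where it does not vanish gives the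
  formula.
\<close>

context raising_setting
begin

lemma shift_closed_Suc: "\<nu> \<in> V \<Longrightarrow> \<nu> + \<sigma> \<in> V"
  using shift_closed[of \<nu> 1] by simp

lemma weight_in_F: "\<nu> \<in> V \<Longrightarrow> w \<nu> \<in> F"
  using w_dom D_maps(1) by blast

text \<open>The division by \<open>w\<close> in one raising operator cancels the multiplication by \<open>w\<close> in the
  operator to its left, so only the outermost weights survive.\<close>

lemma weight_mult_raise:
  assumes "\<nu> \<in> V" and "raise_defined F domD D w R \<sigma> n \<nu> f"
  shows "(\<lambda>x. w \<nu> x * raise R \<sigma> n \<nu> f x) = (D ^^ n) (\<lambda>x. w (\<nu> + real n *\<^sub>R \<sigma>) x * f x)"
  using assms
proof (induction n arbitrary: \<nu>)
  case 0
  then show ?case by simp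
next
  case (Suc n)
  have shift: "\<nu> + \<sigma> + real n *\<^sub>R \<sigma> = \<nu> + real (Suc n) *\<^sub>R \<sigma>"
    by (simp add: scaleR_left_distrib add.assoc)
  have "(\<lambda>x. w \<nu> x * raise R \<sigma> (Suc n) \<nu> f x)
      = D (\<lambda>x. w (\<nu> + \<sigma>) x * raise R \<sigma> n (\<nu> + \<sigma>) f x)"
    using R_conj Suc.prems by (simp add: mult_op_def)
  also have "\<dots> = D ((D ^^ n) (\<lambda>x. w (\<nu> + \<sigma> + real n *\<^sub>R \<sigma>) x * f x))"
    using Suc.IH[of "\<nu> + \<sigma>"] Suc.prems shift_closed_Suc by simp
  finally show ?case by (simp only: shift funpow.simps o_apply)
qed

text \<open>Raising a nonzero polynomial increases its degree, so every iterate is nonzero, which is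
  what allows \<open>R_poly\<close> to be used again at the next step.\<close>

lemma raise_poly_is_poly:
  assumes "\<nu> \<in> V"
  shows "\<exists>q. q \<noteq> 0 \<and> raise_poly R \<sigma> n \<nu> = poly q"
  using assms
proof (induction n arbitrary: \<nu>)
  case 0
  have "(\<lambda>x::complex. 1) = poly 1" by auto
  then show ?case by (auto simp: raise_poly_def intro!: exI[of _ 1])
next
  case (Suc n)
  then obtain q where q: "q \<noteq> 0" "raise_poly R \<sigma> n (\<nu> + \<sigma>) = poly q"
    using shift_closed_Suc by blast
  then obtain r where "R \<nu> (poly q) = poly r" "degree r = degree q + 1"
    using R_poly Suc.prems by blast
  with q have "raise_poly R \<sigma> (Suc n) \<nu> = poly r" "r \<noteq> 0"
    by (auto simp: raise_poly_def)
  then show ?case by blast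
qed

lemma raise_poly_in_F: "\<nu> \<in> V \<Longrightarrow> raise_poly R \<sigma> n \<nu> \<in> F"
  using raise_poly_is_poly F_poly by metis

lemma raise_defined_one: "\<nu> \<in> V \<Longrightarrow> raise_defined F domD D w R \<sigma> n \<nu> (\<lambda>x. 1)"
proof (induction n arbitrary: \<nu>)
  case 0
  then show ?case using raise_poly_in_F[of \<nu> 0] by (simp add: raise_poly_def)
next
  case (Suc n)
  have "raise R \<sigma> n (\<nu> + \<sigma>) (\<lambda>x. 1) \<in> domR \<nu>"
    using raise_poly_is_poly[of "\<nu> + \<sigma>" n] R_poly_dom[OF Suc.prems] shift_closed_Suc[OF Suc.prems]
    by (auto simp: raise_poly_def)
  then show ?case using Suc shift_closed_Suc domR_conj by auto
qed

lemma rodrigues_formula: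
  assumes "\<nu> \<in> V"
  shows "(D ^^ n) (w (\<nu> + real n *\<^sub>R \<sigma>)) = (\<lambda>x. w \<nu> x * raise_poly R \<sigma> n \<nu> x)"
  using weight_mult_raise[OF assms raise_defined_one[OF assms], of n]
  by (simp add: raise_poly_def)

lemma eta_funpow_in_F: "f \<in> F \<Longrightarrow> (\<eta> ^^ k) f \<in> F"
  using bij_betwE[OF \<eta>_bij] by (induction k) auto

lemma eta_funpow_mult:
  assumes "f \<in> F" and "g \<in> F"
  shows "(\<eta> ^^ k) (\<lambda>x. f x * g x) = (\<lambda>x. (\<eta> ^^ k) f x * (\<eta> ^^ k) g x)"
  using assms by (induction k) (auto simp: \<eta>_mult eta_funpow_in_F)

text \<open>Counting the \<open>n - k\<close> steps up to \<open>\<nu> + n\<sigma>\<close> from \<open>\<nu> + k\<sigma>\<close> rather than from \<open>\<nu>\<close>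
  is what makes the Rodrigues formula fit the \<open>k\<close>-th term of the Leibniz rule.\<close>

lemma eta_derivative_weight:
  assumes "\<nu> \<in> V" and "k \<le> n"
  shows "(\<eta> ^^ k) ((D ^^ (n - k)) (w (\<nu> + real n *\<^sub>R \<sigma>))) =
    (\<lambda>x. (\<eta> ^^ k) (w (\<nu> + real k *\<^sub>R \<sigma>)) x
       * (\<eta> ^^ k) (raise_poly R \<sigma> (n - k) (\<nu> + real k *\<^sub>R \<sigma>)) x)"
proof -
  have k: "\<nu> + real k *\<^sub>R \<sigma> \<in> V" using assms(1) by (rule shift_closed)
  have "\<nu> + real n *\<^sub>R \<sigma> = \<nu> + real k *\<^sub>R \<sigma> + real (n - k) *\<^sub>R \<sigma>"
    using assms(2) by (simp add: add.assoc flip: scaleR_left_distrib)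
  then show ?thesis
    by (simp only: rodrigues_formula[OF k] eta_funpow_mult[OF weight_in_F[OF k] raise_poly_in_F[OF k]])
qed

end

theorem theorem2p1:
  fixes V :: "(real ^ 'd) set" and \<sigma> \<nu> :: "real ^ 'd" and \<mu> :: "real ^ 'd \<Rightarrow> real measure"
    and F :: "cfun set" and w :: "real ^ 'd \<Rightarrow> cfun"
    and domD :: "cfun set" and D \<eta> :: "cfun \<Rightarrow> cfun"
    and domT :: "nat \<Rightarrow> nat \<Rightarrow> cfun set" and T :: "nat \<Rightarrow> nat \<Rightarrow> cfun \<Rightarrow> cfun"
    and \<alpha> :: "nat \<Rightarrow> nat \<Rightarrow> complex"
    and domR :: "real ^ 'd \<Rightarrow> cfun set" and R L :: "real ^ 'd \<Rightarrow> cfun \<Rightarrow> cfun"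
    and n :: nat and f :: cfun
  assumes "raising_setting V \<sigma> \<mu> F w domD D \<eta> domT T \<alpha> domR R L"
    and "\<nu> \<in> V"
    and "raise_defined F domD D w R \<sigma> n \<nu> f"
    and "leibniz_applies F domD D domT n (w (\<nu> + real n *\<^sub>R \<sigma>)) f"
  shows "\<forall>x. w \<nu> x \<noteq> 0 \<longrightarrow>
    raise R \<sigma> n \<nu> f x =
      (\<Sum>k=0..n. \<alpha> n k * ((\<eta> ^^ k) (w (\<nu> + real k *\<^sub>R \<sigma>)) x / w \<nu> x)
         * (\<eta> ^^ k) (raise_poly R \<sigma> (n - k) (\<nu> + real k *\<^sub>R \<sigma>)) x * T k n f x)"
proof (intro allI impI)
  interpret raising_setting V \<sigma> \<mu> F w domD D \<eta> domT T \<alpha> domR R L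
    by (rule assms(1))
  fix x
  assume nz: "w \<nu> x \<noteq> 0"
  have "w \<nu> x * raise R \<sigma> n \<nu> f x = (D ^^ n) (\<lambda>x. w (\<nu> + real n *\<^sub>R \<sigma>) x * f x) x"
    by (rule fun_cong[OF weight_mult_raise[OF assms(2,3)]])
  also have "\<dots> = (\<Sum>k=0..n. \<alpha> n k * (\<eta> ^^ k) ((D ^^ (n - k)) (w (\<nu> + real n *\<^sub>R \<sigma>))) x * T k n f x)"
    by (rule leibniz[OF assms(4)])
  also have "\<dots> = (\<Sum>k=0..n. \<alpha> n k * ((\<eta> ^^ k) (w (\<nu> + real k *\<^sub>R \<sigma>)) x
         * (\<eta> ^^ k) (raise_poly R \<sigma> (n - k) (\<nu> + real k *\<^sub>R \<sigma>)) x) * T k n f x)"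
    by (simp add: eta_derivative_weight[OF assms(2)])
  finally have "raise R \<sigma> n \<nu> f x = (\<Sum>k=0..n. \<alpha> n k * ((\<eta> ^^ k) (w (\<nu> + real k *\<^sub>R \<sigma>)) x
         * (\<eta> ^^ k) (raise_poly R \<sigma> (n - k) (\<nu> + real k *\<^sub>R \<sigma>)) x) * T k n f x) / w \<nu> x"
    using nz by (simp add: field_simps)
  then show "raise R \<sigma> n \<nu> f x =
      (\<Sum>k=0..n. \<alpha> n k * ((\<eta> ^^ k) (w (\<nu> + real k *\<^sub>R \<sigma>)) x / w \<nu> x)
         * (\<eta> ^^ k) (raise_poly R \<sigma> (n - k) (\<nu> + real k *\<^sub>R \<sigma>)) x * T k n f x)"
    by (simp add: sum_divide_distrib mult.assoc)
qed

end
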